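(* Let $s\geq 1$ and let $C$ be an $s$-elusive code in $H(m,q)$ with minimum distance $\delta$. Then 1. if $q=2$ then $\delta\leq 2s+2$, and, 2. if $q\geq 3$ then $\delta\leq 2s+1$.
   Context: The Hamming graph $\varGamma=H(m,q)$ has as vertices all $m$-tuples with entries from a set $Q$ of size $q$; two vertices are adjacent iff they differ in exactly one entry. $d(\alpha,\beta)$ is the Hamming distance. A code $C$ is a subset of the vertex set; its minimum distance is $\delta=\min\{d(\alpha,\beta)\mid\alpha,\beta\in C,\ \alpha\neq\beta\}$ (this presupposes that $C$ has at least two codewords). For a vertex $\alpha$, $d(\alpha,C)=\min\{d(\alpha,\beta)\mid\beta\in C\}$; the covering radius $\rho$ of $C$ is the maximum of $d(\alpha,C)$ over all vertices; for $r\leq\rho$ the set of $r$-neighbours is $C_r=\{\alpha\mid d(\alpha,C)=r\}$. Two codes $C,C'$ are equivalent if $C'=C^x$ for some $x$ in the full automorphism group $\mathrm{Aut}(\varGamma)$ of the graph. For $1\leq s\leq\rho$, $C$ is $s$-elusive if there exists a code $C'\neq C$ equivalent to $C$ with $C_s=C'_s$. *)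

theory Defs
  imports Main
begin

text \<open>The Hamming graph over the alphabet \<open>Q\<close>: the vertices are the \<open>m\<close>-tuples over \<open>Q\<close>,
  encoded as lists of length \<open>m\<close>.\<close>

definition hamming_vertices :: "nat \<Rightarrow> 'a set \<Rightarrow> 'a list set" where
  "hamming_vertices m Q = {\<alpha>. length \<alpha> = m \<and> set \<alpha> \<subseteq> Q}"

text \<open>Only meaningful for lists of equal length.\<close>

definition hamming_dist :: "'a list \<Rightarrow> 'a list \<Rightarrow> nat" where
  "hamming_dist \<alpha> \<beta> = card {i. i < length \<alpha> \<and> \<alpha> ! i \<noteq> \<beta> ! i}"

definition hamming_adj :: "'a list \<Rightarrow> 'a list \<Rightarrow> bool" where
  "hamming_adj \<alpha> \<beta> \<longleftrightarrow> hamming_dist \<alpha> \<beta> = 1"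

text \<open>Maps are total functions on lists; their values outside the vertex set are irrelevant.\<close>

definition hamming_aut :: "nat \<Rightarrow> 'a set \<Rightarrow> ('a list \<Rightarrow> 'a list) set" where
  "hamming_aut m Q = {x. bij_betw x (hamming_vertices m Q) (hamming_vertices m Q) \<and>
     (\<forall>\<alpha> \<in> hamming_vertices m Q. \<forall>\<beta> \<in> hamming_vertices m Q.
        hamming_adj (x \<alpha>) (x \<beta>) \<longleftrightarrow> hamming_adj \<alpha> \<beta>)}"

definition is_code :: "nat \<Rightarrow> 'a set \<Rightarrow> 'a list set \<Rightarrow> bool" where
  "is_code m Q C \<longleftrightarrow> C \<subseteq> hamming_vertices m Q"

text \<open>\<open>Min\<close> and \<open>Max\<close> are unspecified on the empty set: \<open>min_distance\<close> requires at least two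
  codewords, \<open>dist_to_code\<close> and the notions built on it require a nonempty code.\<close>

definition min_distance :: "'a list set \<Rightarrow> nat" where
  "min_distance C = Min {hamming_dist \<alpha> \<beta> | \<alpha> \<beta>. \<alpha> \<in> C \<and> \<beta> \<in> C \<and> \<alpha> \<noteq> \<beta>}"

definition dist_to_code :: "'a list \<Rightarrow> 'a list set \<Rightarrow> nat" where
  "dist_to_code \<alpha> C = Min {hamming_dist \<alpha> \<beta> | \<beta>. \<beta> \<in> C}"

definition covering_radius :: "nat \<Rightarrow> 'a set \<Rightarrow> 'a list set \<Rightarrow> nat" where
  "covering_radius m Q C = Max {dist_to_code \<alpha> C | \<alpha>. \<alpha> \<in> hamming_vertices m Q}"

definition code_neighbours :: "nat \<Rightarrow> 'a set \<Rightarrow> nat \<Rightarrow> 'a list set \<Rightarrow> 'a list set" where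
  "code_neighbours m Q r C = {\<alpha> \<in> hamming_vertices m Q. dist_to_code \<alpha> C = r}"

definition code_equivalent :: "nat \<Rightarrow> 'a set \<Rightarrow> 'a list set \<Rightarrow> 'a list set \<Rightarrow> bool" where
  "code_equivalent m Q C C' \<longleftrightarrow> (\<exists>x \<in> hamming_aut m Q. C' = x ` C)"

definition elusive :: "nat \<Rightarrow> 'a set \<Rightarrow> nat \<Rightarrow> 'a list set \<Rightarrow> bool" where
  "elusive m Q s C \<longleftrightarrow> 1 \<le> s \<and> s \<le> covering_radius m Q C \<and>
     (\<exists>C'. code_equivalent m Q C C' \<and> C' \<noteq> C \<and>
           code_neighbours m Q s C = code_neighbours m Q s C')"

end

theory Submission
  imports Defs
begin

text \<open>Let \<open>C' \<noteq> C\<close> be an equivalent code with the same \<open>s\<close>-neighbours. The two codes have the same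
  finite size, so some \<open>\<alpha> \<in> C'\<close> lies outside \<open>C\<close>. The claimed bound exceeds \<open>2 * s\<close>, so one may
  assume \<open>\<delta> > 2 * s\<close>. Automorphisms of the Hamming graph do not shrink distances
  (\<open>hamming_aut_expands\<close>), hence \<open>C'\<close> also has distances above \<open>2 * s\<close> and the whole sphere of
  radius \<open>s\<close> about \<open>\<alpha>\<close> consists of \<open>s\<close>-neighbours of \<open>C'\<close>, that is, of \<open>C\<close>.

  So every \<open>\<nu>\<close> on this sphere is at distance \<open>s\<close> from a codeword \<open>\<beta>\<close> of \<open>C\<close>, and
  \<open>\<beta> \<noteq> \<alpha>\<close> as \<open>\<alpha> \<notin> C\<close>. No such \<open>\<beta>\<close> is at distance \<open>s\<close> from all of the
  sphere, and this already fails close to \<open>\<nu>\<close>: one can move along the sphere to a vertex \<open>\<nu>'\<close> whose distance from \<open>\<beta>\<close> is not \<open>s\<close>, changing a single entry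
  if the alphabet has a third letter (\<open>leave_sphere_one_entry\<close>) and two entries otherwise
  (\<open>leave_sphere_two_entries\<close>). The codeword \<open>\<beta>'\<close> at distance \<open>s\<close> from \<open>\<nu>'\<close> then differs from
  \<open>\<beta>\<close>, and the path \<open>\<beta>, \<nu>, \<nu>', \<beta>'\<close> bounds \<open>\<delta>\<close> by \<open>2 * s + 1\<close> or \<open>2 * s + 2\<close>
  (\<open>close_codewords_of_covered_sphere\<close>).\<close>

section \<open>The Hamming distance as a metric\<close>

lemma hamming_dist_commute:
  "length \<alpha> = length \<beta> \<Longrightarrow> hamming_dist \<alpha> \<beta> = hamming_dist \<beta> \<alpha>"
  by (simp add: hamming_dist_def eq_commute)

lemma hamming_dist_refl [simp]: "hamming_dist \<alpha> \<alpha> = 0"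
  by (simp add: hamming_dist_def)

lemma hamming_dist_eq_0_imp:
  assumes "length \<alpha> = length \<beta>" "hamming_dist \<alpha> \<beta> = 0"
  shows "\<alpha> = \<beta>"
  using assms by (auto simp: hamming_dist_def intro: nth_equalityI)

lemma hamming_dist_le_length: "hamming_dist \<alpha> \<beta> \<le> length \<alpha>"
proof -
  have "hamming_dist \<alpha> \<beta> \<le> card {..<length \<alpha>}"
    unfolding hamming_dist_def by (rule card_mono) auto
  then show ?thesis by simp
qed

lemma hamming_dist_triangle:
  assumes "length \<alpha> = length \<beta>"
  shows "hamming_dist \<alpha> \<gamma> \<le> hamming_dist \<alpha> \<beta> + hamming_dist \<beta> \<gamma>"
proof -
  have "hamming_dist \<alpha> \<gamma> \<le>
      card ({i. i < length \<alpha> \<and> \<alpha> ! i \<noteq> \<beta> ! i} \<union> {i. i < length \<beta> \<and> \<beta> ! i \<noteq> \<gamma> ! i})"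
    unfolding hamming_dist_def by (rule card_mono) (use assms in auto)
  also have "\<dots> \<le> hamming_dist \<alpha> \<beta> + hamming_dist \<beta> \<gamma>"
    unfolding hamming_dist_def by (rule card_Un_le)
  finally show ?thesis .
qed

lemma hamming_dist_update:
  assumes "i < length \<alpha>"
  shows "hamming_dist (\<alpha>[i := c]) \<beta> + of_bool (\<alpha> ! i \<noteq> \<beta> ! i) = hamming_dist \<alpha> \<beta> + of_bool (c \<noteq> \<beta> ! i)"
proof -
  define R where "R = {j. j < length \<alpha> \<and> j \<noteq> i \<and> \<alpha> ! j \<noteq> \<beta> ! j}"
  have R: "finite R" "i \<notin> R" by (auto simp: R_def)
  have "{j. j < length \<alpha> \<and> \<alpha> ! j \<noteq> \<beta> ! j} = (if \<alpha> ! i \<noteq> \<beta> ! i then insert i R else R)"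
    and "{j. j < length (\<alpha>[i := c]) \<and> \<alpha>[i := c] ! j \<noteq> \<beta> ! j} = (if c \<noteq> \<beta> ! i then insert i R else R)"
    using assms by (auto simp: R_def nth_list_update split: if_splits)
  then show ?thesis
    using R by (simp add: hamming_dist_def)
qed

lemma hamming_dist_update_self:
  "i < length \<alpha> \<Longrightarrow> hamming_dist (\<alpha>[i := c]) \<alpha> \<le> 1"
  using hamming_dist_update[of i \<alpha> c \<alpha>] by simp

lemma finite_hamming_vertices: "finite Q \<Longrightarrow> finite (hamming_vertices m Q)"
  unfolding hamming_vertices_def using finite_lists_length_eq[of Q m] by (simp add: conj_commute)

lemma update_hamming_vertices:
  "\<alpha> \<in> hamming_vertices m Q \<Longrightarrow> c \<in> Q \<Longrightarrow> \<alpha>[i := c] \<in> hamming_vertices m Q"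
  unfolding hamming_vertices_def using set_update_subset_insert[of \<alpha> i c] by auto

lemma nth_hamming_vertices:
  "\<alpha> \<in> hamming_vertices m Q \<Longrightarrow> i < m \<Longrightarrow> \<alpha> ! i \<in> Q"
  unfolding hamming_vertices_def by auto

lemma length_hamming_vertices: "\<alpha> \<in> hamming_vertices m Q \<Longrightarrow> length \<alpha> = m"
  unfolding hamming_vertices_def by simp

section \<open>Automorphisms do not shrink distances\<close>

text \<open>The Hamming distance is the path metric of the graph: a shortest path between the images
  pulls back, edge by edge, to a path between the original vertices.\<close>

lemma hamming_aut_expands:
  assumes x: "x \<in> hamming_aut m Q"
    and V: "\<alpha> \<in> hamming_vertices m Q" "\<beta> \<in> hamming_vertices m Q"
  shows "hamming_dist \<alpha> \<beta> \<le> hamming_dist (x \<alpha>) (x \<beta>)"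
  using V(1)
proof (induction "hamming_dist (x \<alpha>) (x \<beta>)" arbitrary: \<alpha>)
  case 0
  have bij: "bij_betw x (hamming_vertices m Q) (hamming_vertices m Q)"
    using x by (simp add: hamming_aut_def)
  have "x \<alpha> = x \<beta>"
    using 0 V(2) bij by (metis bij_betwE hamming_dist_eq_0_imp length_hamming_vertices)
  then have "\<alpha> = \<beta>"
    using 0 V(2) bij by (metis bij_betw_def inj_onD)
  then show ?case by simp
next
  case (Suc n)
  have bij: "bij_betw x (hamming_vertices m Q) (hamming_vertices m Q)"
    using x by (simp add: hamming_aut_def)
  then have xV: "x \<alpha> \<in> hamming_vertices m Q" "x \<beta> \<in> hamming_vertices m Q"
    using Suc.prems V(2) by (auto dest: bij_betwE)
  have "{i. i < length (x \<alpha>) \<and> x \<alpha> ! i \<noteq> x \<beta> ! i} \<noteq> {}"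
    using Suc.hyps(2) unfolding hamming_dist_def by (metis card.empty nat.distinct(1))
  then obtain i where i: "i < length (x \<alpha>)" "x \<alpha> ! i \<noteq> x \<beta> ! i" by auto
  define w where "w = (x \<alpha>)[i := x \<beta> ! i]"
  have "w \<in> hamming_vertices m Q"
    unfolding w_def using xV i
    by (metis length_hamming_vertices nth_hamming_vertices update_hamming_vertices)
  then obtain \<gamma> where \<gamma>: "\<gamma> \<in> hamming_vertices m Q" "x \<gamma> = w"
    using bij by (metis bij_betw_imp_surj_on imageE)
  have "hamming_dist w (x \<alpha>) = 1"
    using hamming_dist_update[OF i(1), of "x \<beta> ! i" "x \<alpha>"] i by (simp add: w_def)
  then have "hamming_dist \<gamma> \<alpha> = 1"
    using x \<gamma> Suc.prems unfolding hamming_aut_def hamming_adj_def by blast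
  moreover have "hamming_dist w (x \<beta>) = n"
    using hamming_dist_update[OF i(1), of "x \<beta> ! i" "x \<beta>"] i Suc.hyps(2) by (simp add: w_def)
  then have "hamming_dist \<gamma> \<beta> \<le> n"
    using Suc.hyps(1) \<gamma> by metis
  ultimately show ?case
    using hamming_dist_triangle[of \<alpha> \<gamma> \<beta>] Suc.hyps(2) Suc.prems \<gamma>(1)
    by (simp add: hamming_dist_commute length_hamming_vertices)
qed

section \<open>Moving along a sphere\<close>

lemma hamming_sphere_nonempty:
  assumes "card Q \<ge> 2" "\<alpha> \<in> hamming_vertices m Q" "s \<le> m"
  shows "\<exists>\<nu>\<in>hamming_vertices m Q. hamming_dist \<nu> \<alpha> = s"
  using assms(3)
proof (induction s)
  case 0
  then show ?case using assms(2) hamming_dist_refl by blast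
next
  case (Suc s)
  then obtain \<nu> where \<nu>: "\<nu> \<in> hamming_vertices m Q" "hamming_dist \<nu> \<alpha> = s" by auto
  then have len: "length \<nu> = m" by (simp add: length_hamming_vertices)
  obtain i where i: "i < m" "\<nu> ! i = \<alpha> ! i"
  proof (rule ccontr)
    assume "\<not> thesis"
    then have "{i. i < length \<nu> \<and> \<nu> ! i \<noteq> \<alpha> ! i} = {..<m}"
      using that len by auto
    then show False
      using \<nu>(2) Suc.prems by (simp add: hamming_dist_def)
  qed
  have "\<not> Q \<subseteq> {\<alpha> ! i}"
    using card_mono[of "{\<alpha> ! i}" Q] assms(1) by auto
  then obtain c where c: "c \<in> Q" "c \<noteq> \<alpha> ! i" by auto
  have "hamming_dist (\<nu>[i := c]) \<alpha> = Suc s"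
    using hamming_dist_update[of i \<nu> c \<alpha>] i c len \<nu>(2) by simp
  then show ?case
    using update_hamming_vertices[OF \<nu>(1) c(1)] by blast
qed

text \<open>If \<open>\<alpha>\<close> agreed with \<open>\<nu>\<close> or with \<open>\<beta>\<close> in every position, it would lie on a shortest path
  from \<open>\<nu>\<close> to \<open>\<beta>\<close>, strictly closer to \<open>\<nu>\<close> than \<open>\<beta>\<close> is.\<close>

lemma common_difference_position:
  assumes "length \<alpha> = m" "length \<beta> = m" "length \<nu> = m"
    and "hamming_dist \<nu> \<beta> \<le> hamming_dist \<nu> \<alpha>" "\<alpha> \<noteq> \<beta>"
  shows "\<exists>i<m. \<nu> ! i \<noteq> \<alpha> ! i \<and> \<beta> ! i \<noteq> \<alpha> ! i"
proof (rule ccontr)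
  assume *: "\<not> ?thesis"
  obtain j where "j < m" "\<alpha> ! j \<noteq> \<beta> ! j"
    using assms nth_equalityI by metis
  then have "j \<in> {i. i < length \<nu> \<and> \<nu> ! i \<noteq> \<beta> ! i} - {i. i < length \<nu> \<and> \<nu> ! i \<noteq> \<alpha> ! i}"
    using * assms(3) by auto
  moreover have "{i. i < length \<nu> \<and> \<nu> ! i \<noteq> \<alpha> ! i} \<subseteq> {i. i < length \<nu> \<and> \<nu> ! i \<noteq> \<beta> ! i}"
    using * assms(3) by auto
  ultimately have
    "{i. i < length \<nu> \<and> \<nu> ! i \<noteq> \<alpha> ! i} \<subset> {i. i < length \<nu> \<and> \<nu> ! i \<noteq> \<beta> ! i}"
    by blast
  then have "hamming_dist \<nu> \<alpha> < hamming_dist \<nu> \<beta>"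
    unfolding hamming_dist_def by (intro psubset_card_mono) auto
  then show False using assms by simp
qed

text \<open>At a position where \<open>\<alpha>\<close> differs from both \<open>\<nu>\<close> and \<open>\<beta>\<close>, the entry of \<open>\<nu>\<close> may be
  replaced by any other letter but the one of \<open>\<alpha>\<close> without leaving the sphere about \<open>\<alpha>\<close>; three
  letters suffice to switch between agreeing and disagreeing with \<open>\<beta>\<close> there.\<close>

lemma leave_sphere_one_entry:
  assumes Q: "card Q \<ge> 3"
    and V: "\<alpha> \<in> hamming_vertices m Q" "\<beta> \<in> hamming_vertices m Q" "\<nu> \<in> hamming_vertices m Q"
    and d: "hamming_dist \<nu> \<alpha> = s" "hamming_dist \<nu> \<beta> = s" "\<alpha> \<noteq> \<beta>"
  shows "\<exists>\<nu>'\<in>hamming_vertices m Q.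
    hamming_dist \<nu>' \<alpha> = s \<and> hamming_dist \<nu>' \<beta> \<noteq> s \<and> hamming_dist \<nu>' \<nu> \<le> 1"
proof -
  note len = V[THEN length_hamming_vertices]
  obtain i where i: "i < m" "\<nu> ! i \<noteq> \<alpha> ! i" "\<beta> ! i \<noteq> \<alpha> ! i"
    using common_difference_position[of \<alpha> m \<beta> \<nu>] len d by auto
  have "\<not> Q \<subseteq> {\<alpha> ! i, \<beta> ! i}"
    using card_mono[of "{\<alpha> ! i, \<beta> ! i}" Q] Q card_insert_le_m1[of 2 "{\<beta> ! i}" "\<alpha> ! i"] by auto
  then obtain c0 where "c0 \<in> Q" "c0 \<noteq> \<alpha> ! i" "c0 \<noteq> \<beta> ! i" by auto
  then obtain c where c: "c \<in> Q" "c \<noteq> \<alpha> ! i" "(c = \<beta> ! i) \<noteq> (\<nu> ! i = \<beta> ! i)"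
    using i V(2) nth_hamming_vertices by metis
  have "hamming_dist (\<nu>[i := c]) \<alpha> = s"
    using hamming_dist_update[of i \<nu> c \<alpha>] i c len d by simp
  moreover have "hamming_dist (\<nu>[i := c]) \<beta> \<noteq> s"
    using hamming_dist_update[of i \<nu> c \<beta>] i c len d by (auto split: if_splits)
  moreover have "hamming_dist (\<nu>[i := c]) \<nu> \<le> 1"
    by (rule hamming_dist_update_self) (use i len in simp)
  ultimately show ?thesis
    using update_hamming_vertices[OF V(3) c(1)] by blast
qed

text \<open>Over two letters the sphere has no adjacent vertices, so an entry \<open>i\<close> where \<open>\<nu>\<close> differs from
  \<open>\<alpha>\<close> is restored and an entry \<open>j\<close> is spoilt instead. With \<open>\<alpha>\<close> and \<open>\<beta>\<close> different at \<open>i\<close> and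
  all three words equal at \<open>j\<close>, this moves away from \<open>\<beta>\<close>; the bound \<open>2 * s < m\<close> leaves room for
  such a \<open>j\<close>.\<close>

lemma leave_sphere_two_entries:
  assumes Q: "card Q \<ge> 2" and m: "2 * s < m"
    and V: "\<alpha> \<in> hamming_vertices m Q" "\<beta> \<in> hamming_vertices m Q" "\<nu> \<in> hamming_vertices m Q"
    and d: "hamming_dist \<nu> \<alpha> = s" "hamming_dist \<nu> \<beta> = s" "\<alpha> \<noteq> \<beta>"
  shows "\<exists>\<nu>'\<in>hamming_vertices m Q.
    hamming_dist \<nu>' \<alpha> = s \<and> hamming_dist \<nu>' \<beta> \<noteq> s \<and> hamming_dist \<nu>' \<nu> \<le> 2"
proof -
  note len = V[THEN length_hamming_vertices]
  obtain i where i: "i < m" "\<nu> ! i \<noteq> \<alpha> ! i" "\<beta> ! i \<noteq> \<alpha> ! i"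
    using common_difference_position[of \<alpha> m \<beta> \<nu>] len d by auto
  have "\<exists>j<m. \<nu> ! j = \<alpha> ! j \<and> \<nu> ! j = \<beta> ! j"
  proof (rule ccontr)
    assume "\<not> ?thesis"
    then have "{i. i < length \<nu> \<and> \<nu> ! i \<noteq> \<alpha> ! i} \<union> {i. i < length \<nu> \<and> \<nu> ! i \<noteq> \<beta> ! i} = {..<m}"
      using len by auto
    then have "m \<le> hamming_dist \<nu> \<alpha> + hamming_dist \<nu> \<beta>"
      using card_Un_le[of "{i. i < length \<nu> \<and> \<nu> ! i \<noteq> \<alpha> ! i}" "{i. i < length \<nu> \<and> \<nu> ! i \<noteq> \<beta> ! i}"]
      by (simp add: hamming_dist_def)
    then show False using d m by simp
  qed
  then obtain j where j: "j < m" "\<nu> ! j = \<alpha> ! j" "\<nu> ! j = \<beta> ! j" by blast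
  have ij: "i \<noteq> j" using i j by auto
  have "\<not> Q \<subseteq> {\<alpha> ! j}"
    using card_mono[of "{\<alpha> ! j}" Q] Q by auto
  then obtain c where c: "c \<in> Q" "c \<noteq> \<alpha> ! j" by auto
  define \<mu> where "\<mu> = \<nu>[j := c]"
  define \<nu>' where "\<nu>' = \<mu>[i := \<alpha> ! i]"
  have \<mu>: "\<mu> \<in> hamming_vertices m Q" "length \<mu> = m" "\<mu> ! i = \<nu> ! i"
    using update_hamming_vertices[OF V(3) c(1)] len ij by (auto simp: \<mu>_def)
  have "hamming_dist \<mu> \<alpha> = Suc s"
    using hamming_dist_update[of j \<nu> c \<alpha>] j c len d by (simp add: \<mu>_def)
  then have "hamming_dist \<nu>' \<alpha> = s"
    using hamming_dist_update[of i \<mu> "\<alpha> ! i" \<alpha>] i \<mu> by (simp add: \<nu>'_def)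
  moreover have "hamming_dist \<mu> \<beta> = Suc s"
    using hamming_dist_update[of j \<nu> c \<beta>] j c len d by (simp add: \<mu>_def)
  then have "hamming_dist \<nu>' \<beta> > s"
    using hamming_dist_update[of i \<mu> "\<alpha> ! i" \<beta>] i \<mu> by (simp add: \<nu>'_def of_bool_def split: if_splits)
  moreover have "hamming_dist \<nu>' \<nu> \<le> 2"
    using hamming_dist_triangle[of \<nu>' \<mu> \<nu>] hamming_dist_update_self[of i \<mu> "\<alpha> ! i"]
      hamming_dist_update_self[of j \<nu> c] i j len \<mu> by (simp add: \<nu>'_def \<mu>_def)
  moreover have "\<nu>' \<in> hamming_vertices m Q"
    unfolding \<nu>'_def using update_hamming_vertices[OF \<mu>(1)] nth_hamming_vertices[OF V(1) i(1)] by blast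
  ultimately show ?thesis by (metis less_irrefl)
qed

section \<open>Spheres inside the set of \<open>s\<close>-neighbours\<close>

lemma close_codewords_of_covered_sphere:
  assumes C: "C \<subseteq> hamming_vertices m Q"
    and \<alpha>: "\<alpha> \<in> hamming_vertices m Q" "\<alpha> \<notin> C"
    and \<nu>: "\<nu> \<in> hamming_vertices m Q" "hamming_dist \<nu> \<alpha> = s"
    and cover: "\<And>\<nu>. \<nu> \<in> hamming_vertices m Q \<Longrightarrow> hamming_dist \<nu> \<alpha> = s \<Longrightarrow>
      \<exists>\<beta>\<in>C. hamming_dist \<nu> \<beta> = s"
    and leave: "\<And>\<beta>. \<beta> \<in> hamming_vertices m Q \<Longrightarrow> \<alpha> \<noteq> \<beta> \<Longrightarrow> hamming_dist \<nu> \<beta> = s \<Longrightarrow>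
      \<exists>\<nu>'\<in>hamming_vertices m Q.
        hamming_dist \<nu>' \<alpha> = s \<and> hamming_dist \<nu>' \<beta> \<noteq> s \<and> hamming_dist \<nu>' \<nu> \<le> t"
  shows "\<exists>\<beta>\<in>C. \<exists>\<beta>'\<in>C. \<beta> \<noteq> \<beta>' \<and> hamming_dist \<beta> \<beta>' \<le> 2 * s + t"
proof -
  obtain \<beta> where \<beta>: "\<beta> \<in> C" "hamming_dist \<nu> \<beta> = s"
    using cover[OF \<nu>] by blast
  have "\<beta> \<in> hamming_vertices m Q" "\<alpha> \<noteq> \<beta>"
    using \<beta>(1) C \<alpha>(2) by auto
  from leave[OF this \<beta>(2)] obtain \<nu>' where \<nu>': "\<nu>' \<in> hamming_vertices m Q" "hamming_dist \<nu>' \<alpha> = s"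
      "hamming_dist \<nu>' \<beta> \<noteq> s" "hamming_dist \<nu>' \<nu> \<le> t"
    by blast
  from cover[OF \<nu>'(1,2)] obtain \<beta>' where \<beta>': "\<beta>' \<in> C" "hamming_dist \<nu>' \<beta>' = s"
    by blast
  have len: "length \<beta> = m" "length \<beta>' = m" "length \<nu> = m" "length \<nu>' = m"
    using C \<beta>(1) \<beta>'(1) \<nu>(1) \<nu>'(1) by (auto simp: length_hamming_vertices)
  have "hamming_dist \<beta> \<beta>' \<le> hamming_dist \<beta> \<nu> + (hamming_dist \<nu> \<nu>' + hamming_dist \<nu>' \<beta>')"
    using hamming_dist_triangle[of \<beta> \<nu> \<beta>'] hamming_dist_triangle[of \<nu> \<nu>' \<beta>'] len by simp
  moreover have "hamming_dist \<beta> \<nu> = s" "hamming_dist \<nu> \<nu>' \<le> t"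
    using \<beta>(2) \<nu>'(4) len by (simp_all add: hamming_dist_commute[of \<beta> \<nu>] hamming_dist_commute[of \<nu> \<nu>'])
  ultimately have "hamming_dist \<beta> \<beta>' \<le> 2 * s + t"
    using \<beta>'(2) by linarith
  moreover have "\<beta> \<noteq> \<beta>'"
    using \<beta>'(2) \<nu>'(3) by blast
  ultimately show ?thesis
    using \<beta>(1) \<beta>'(1) by blast
qed

lemma hamming_dist_set_finite:
  assumes "finite C"
  shows "finite {hamming_dist \<nu> \<beta> | \<beta>. \<beta> \<in> C}"
    and "finite {hamming_dist \<alpha> \<beta> | \<alpha> \<beta>. \<alpha> \<in> C \<and> \<beta> \<in> C \<and> \<alpha> \<noteq> \<beta>}"
proof -
  show "finite {hamming_dist \<nu> \<beta> | \<beta>. \<beta> \<in> C}"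
    using assms by simp
  have "{hamming_dist \<alpha> \<beta> | \<alpha> \<beta>. \<alpha> \<in> C \<and> \<beta> \<in> C \<and> \<alpha> \<noteq> \<beta>} \<subseteq> case_prod hamming_dist ` (C \<times> C)"
    by auto
  then show "finite {hamming_dist \<alpha> \<beta> | \<alpha> \<beta>. \<alpha> \<in> C \<and> \<beta> \<in> C \<and> \<alpha> \<noteq> \<beta>}"
    using assms finite_subset by blast
qed

lemma min_distance_le:
  "finite C \<Longrightarrow> \<alpha> \<in> C \<Longrightarrow> \<beta> \<in> C \<Longrightarrow> \<alpha> \<noteq> \<beta> \<Longrightarrow> min_distance C \<le> hamming_dist \<alpha> \<beta>"
  unfolding min_distance_def by (rule Min_le[OF hamming_dist_set_finite(2)]) auto

lemma dist_to_code_attained: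
  assumes "finite C" "C \<noteq> {}"
  shows "\<exists>\<beta>\<in>C. hamming_dist \<nu> \<beta> = dist_to_code \<nu> C"
proof -
  have "dist_to_code \<nu> C \<in> {hamming_dist \<nu> \<beta> | \<beta>. \<beta> \<in> C}"
    unfolding dist_to_code_def
    by (rule Min_in[OF hamming_dist_set_finite(1)]) (use assms in auto)
  then show ?thesis by auto
qed

lemma sphere_subset_code_neighbours:
  assumes "finite C" "C \<subseteq> hamming_vertices m Q" "\<alpha> \<in> C"
    and far: "\<And>\<beta>. \<beta> \<in> C \<Longrightarrow> \<beta> \<noteq> \<alpha> \<Longrightarrow> 2 * s \<le> hamming_dist \<alpha> \<beta>"
    and \<nu>: "\<nu> \<in> hamming_vertices m Q" "hamming_dist \<nu> \<alpha> = s"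
  shows "\<nu> \<in> code_neighbours m Q s C"
proof -
  have "s \<le> hamming_dist \<nu> \<beta>" if "\<beta> \<in> C" for \<beta>
  proof (cases "\<beta> = \<alpha>")
    case False
    have len: "length \<alpha> = m" "length \<nu> = m"
      using assms(2,3) \<nu>(1) by (auto simp: length_hamming_vertices)
    show ?thesis
      using far[OF that False] hamming_dist_triangle[of \<alpha> \<nu> \<beta>] hamming_dist_commute[of \<alpha> \<nu>]
        len \<nu>(2) by simp
  qed (use \<nu>(2) in simp)
  then have "dist_to_code \<nu> C = s"
    unfolding dist_to_code_def
    by (intro Min_eqI hamming_dist_set_finite) (use assms(1,3) \<nu>(2) in auto)
  then show ?thesis
    using \<nu>(1) by (simp add: code_neighbours_def)
qed

theorem theorem5p7:
  fixes Q :: "'a set" and C :: "'a list set" and m q s \<delta> :: nat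
  assumes "finite Q" and "card Q = q"
    and "s \<ge> 1"
    and "is_code m Q C"
    and "\<exists>\<alpha>\<in>C. \<exists>\<beta>\<in>C. \<alpha> \<noteq> \<beta>"
    and "min_distance C = \<delta>"
    and "elusive m Q s C"
  shows "(q = 2 \<longrightarrow> \<delta> \<le> 2 * s + 2) \<and> (q \<ge> 3 \<longrightarrow> \<delta> \<le> 2 * s + 1)"
proof (cases "q \<ge> 2 \<and> 2 * s < \<delta>")
  case True
  then have q: "card Q \<ge> 2" and \<delta>: "2 * s < \<delta>" using assms(2) by auto
  have C: "C \<subseteq> hamming_vertices m Q" using assms(4) by (simp add: is_code_def)
  then have fin: "finite C"
    using finite_hamming_vertices[OF assms(1)] finite_subset by blast
  obtain x C' where x: "x \<in> hamming_aut m Q" and C': "C' = x ` C" "C' \<noteq> C"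
    and eq: "code_neighbours m Q s C = code_neighbours m Q s C'"
    using assms(7) by (auto simp: elusive_def code_equivalent_def)
  have bij: "bij_betw x (hamming_vertices m Q) (hamming_vertices m Q)"
    using x by (simp add: hamming_aut_def)
  then have C'V: "C' \<subseteq> hamming_vertices m Q"
    using C C'(1) by (auto dest: bij_betwE)
  have "card C' = card C"
    using bij C C'(1) by (metis bij_betw_def card_image inj_on_subset)
  then obtain \<alpha> where \<alpha>: "\<alpha> \<in> C'" "\<alpha> \<notin> C"
    using fin C'(2) card_subset_eq by blast
  then have \<alpha>V: "\<alpha> \<in> hamming_vertices m Q" using C'V by blast
  have far: "2 * s \<le> hamming_dist \<alpha> \<beta>" if \<beta>: "\<beta> \<in> C'" "\<beta> \<noteq> \<alpha>" for \<beta>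
  proof -
    obtain a b where ab: "a \<in> C" "b \<in> C" "\<alpha> = x a" "\<beta> = x b"
      using \<alpha>(1) \<beta>(1) C'(1) by blast
    have "\<delta> \<le> hamming_dist a b"
      using min_distance_le[OF fin ab(1,2)] ab(3,4) \<beta>(2) assms(6) by blast
    also have "\<dots> \<le> hamming_dist \<alpha> \<beta>"
      using hamming_aut_expands[OF x] ab C by blast
    finally show ?thesis using \<delta> by simp
  qed
  have cover: "\<exists>\<beta>\<in>C. hamming_dist \<nu> \<beta> = s"
    if \<nu>: "\<nu> \<in> hamming_vertices m Q" "hamming_dist \<nu> \<alpha> = s" for \<nu>
  proof -
    have "\<nu> \<in> code_neighbours m Q s C"
      using sphere_subset_code_neighbours[OF _ C'V \<alpha>(1) far \<nu>] fin C'(1) eq by blast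
    moreover have "C \<noteq> {}" using assms(5) by blast
    ultimately show ?thesis
      using dist_to_code_attained[OF fin, of \<nu>] by (auto simp: code_neighbours_def)
  qed
  obtain a b where "a \<in> C" "b \<in> C" "a \<noteq> b" using assms(5) by blast
  then have "\<delta> \<le> m"
    using min_distance_le[OF fin, of a b] hamming_dist_le_length[of a b] assms(6) C
    by (auto simp: length_hamming_vertices)
  then have m: "2 * s < m" using \<delta> by simp
  then obtain \<nu> where \<nu>: "\<nu> \<in> hamming_vertices m Q" "hamming_dist \<nu> \<alpha> = s"
    using hamming_sphere_nonempty[OF q \<alpha>V, of s] by auto
  note close = close_codewords_of_covered_sphere[OF C \<alpha>V \<alpha>(2) \<nu>, OF cover]
  have bound: "\<delta> \<le> k" if "\<exists>\<beta>\<in>C. \<exists>\<beta>'\<in>C. \<beta> \<noteq> \<beta>' \<and> hamming_dist \<beta> \<beta>' \<le> k" for k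
    using that min_distance_le[OF fin] assms(6) le_trans by blast
  have "\<delta> \<le> 2 * s + 2"
  proof (rule bound, rule close)
    fix \<beta> assume "\<beta> \<in> hamming_vertices m Q" "\<alpha> \<noteq> \<beta>" "hamming_dist \<nu> \<beta> = s"
    then show "\<exists>\<nu>'\<in>hamming_vertices m Q.
        hamming_dist \<nu>' \<alpha> = s \<and> hamming_dist \<nu>' \<beta> \<noteq> s \<and> hamming_dist \<nu>' \<nu> \<le> 2"
      by (intro leave_sphere_two_entries[OF q m \<alpha>V _ \<nu>])
  qed
  moreover have "\<delta> \<le> 2 * s + 1" if "q \<ge> 3"
  proof (rule bound, rule close)
    fix \<beta> assume "\<beta> \<in> hamming_vertices m Q" "\<alpha> \<noteq> \<beta>" "hamming_dist \<nu> \<beta> = s"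
    with that assms(2) show "\<exists>\<nu>'\<in>hamming_vertices m Q.
        hamming_dist \<nu>' \<alpha> = s \<and> hamming_dist \<nu>' \<beta> \<noteq> s \<and> hamming_dist \<nu>' \<nu> \<le> 1"
      by (intro leave_sphere_one_entry[OF _ \<alpha>V _ \<nu>]) simp_all
  qed
  ultimately show ?thesis by blast
qed auto

end
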